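(* Let $X,Y$ be metric spaces with $X$ complete, $F:X\times\mathbb{R}_+\rightrightarrows Y$ a set-valued mapping, $W\subset X\times Y$, and $\mu:[0,+\infty]\to[0,+\infty]$ a continuous nondecreasing function with $\mu(\tau)=0$ if and only if $\tau=0$. Suppose that $F^{-1}$ is closed-valued on $p_Y(W)$ and, for any $(x,y)\in W$ and $u\in U_{x,y}$, there exists a point $u'\ne u$ in $X$ such that $$\mu(\delta(y,F,u'))\le\mu(\delta(y,F,u))-d(u,u').$$ Then $F$ is regular on $W$ with functional modulus $\mu$, i.e. $d(x,F_0^{-1}(y))\le\mu(\delta(y,F,x))$ for all $(x,y)\in W$.
   Context: $\mathbb{R}_+=[0,\infty)$. $d(x,C)=\inf_{c\in C}d(x,c)$, with $d(x,\emptyset)=+\infty$. Set-valued mappings have possibly empty values; $F^{-1}(y)=\{(x,t)\in X\times\mathbb{R}_+\mid y\in F(x,t)\}$, $F_0^{-1}(y)=\{x\in X\mid y\in F(x,0)\}$, $\delta(y,F,x):=\inf\{t>0\mid y\in F(x,t)\}$ (with $\inf\emptyset=+\infty$). $p_Y(x,y)=y$ is the canonical projection. "$F^{-1}$ is closed-valued on $p_Y(W)$" means $F^{-1}(y)$ is a closed subset of $X\times\mathbb{R}_+$ for every $y\in p_Y(W)$. For $(x,y)\in W$, $$U_{x,y}:=\{u\in X\mid\delta(y,F,u)>0,\ \mu(\delta(y,F,u))+d(u,x)\le\mu(\delta(y,F,x))\}.$$ *)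

theory Defs
  imports "HOL-Analysis.Analysis"
begin

text \<open>
  A set-valued mapping from \<open>X \<times> [0,\<infinity>)\<close> to \<open>Y\<close> is represented by a function
  \<open>F :: 'a \<times> real \<Rightarrow> 'b set\<close>; its values at negative second arguments are never used.
  The interval \<open>[0,\<infinity>]\<close> is the type \<^typ>\<open>ennreal\<close>, in which \<^term>\<open>Inf {} = (\<infinity>::ennreal)\<close>.
\<close>

text \<open>
  The library's \<^const>\<open>infdist\<close> has value 0 on the empty set; here the distance to the
  empty set is \<open>\<infinity>\<close>.
\<close>

definition edist_set :: "'a::metric_space \<Rightarrow> 'a set \<Rightarrow> ennreal" where
  "edist_set x C = (INF c\<in>C. ennreal (dist x c))"

definition Finv :: "('a \<times> real \<Rightarrow> 'b set) \<Rightarrow> 'b \<Rightarrow> ('a \<times> real) set" where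
  "Finv F y = {(x, t). 0 \<le> t \<and> y \<in> F (x, t)}"

definition F0inv :: "('a \<times> real \<Rightarrow> 'b set) \<Rightarrow> 'b \<Rightarrow> 'a set" where
  "F0inv F y = {x. y \<in> F (x, 0)}"

definition delta :: "'b \<Rightarrow> ('a \<times> real \<Rightarrow> 'b set) \<Rightarrow> 'a \<Rightarrow> ennreal" where
  "delta y F x = Inf (ennreal ` {t. 0 < t \<and> y \<in> F (x, t)})"

definition inverse_closed_valued_on ::
    "('a::topological_space \<times> real \<Rightarrow> 'b set) \<Rightarrow> 'b set \<Rightarrow> bool" where
  "inverse_closed_valued_on F V \<longleftrightarrow>
     (\<forall>y\<in>V. closedin (top_of_set (UNIV \<times> {0..})) (Finv F y))"

definition U_set ::
    "('a::metric_space \<times> real \<Rightarrow> 'b set) \<Rightarrow> (ennreal \<Rightarrow> ennreal) \<Rightarrow> 'a \<Rightarrow> 'b \<Rightarrow> 'a set" where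
  "U_set F \<mu> x y =
     {u. 0 < delta y F u \<and> \<mu> (delta y F u) + ennreal (dist u x) \<le> \<mu> (delta y F x)}"

definition regular_on ::
    "('a::metric_space \<times> real \<Rightarrow> 'b set) \<Rightarrow> ('a \<times> 'b) set \<Rightarrow> (ennreal \<Rightarrow> ennreal) \<Rightarrow> bool" where
  "regular_on F W \<mu> \<longleftrightarrow>
     (\<forall>(x, y)\<in>W. edist_set x (F0inv F y) \<le> \<mu> (delta y F x))"

end

theory Submission
  imports Defs
begin

text \<open>
  Fix \<open>(x, y) \<in> W\<close> and write \<open>f u = \<mu> (delta y F u)\<close>.  The hypothesis on \<open>U_set\<close> is a
  Caristi-type descent condition: from each point of \<open>U_set F \<mu> x y\<close> one can move to a different
  point while paying for the distance with a decrease of \<open>f\<close>.  Ekeland's variational principle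
  (\<open>ekeland_principle\<close>) yields a point reachable from \<open>x\<close> in this way from which no
  such move is possible.  The condition must therefore fail at that point, and it can fail only
  where \<open>delta\<close> vanishes, hence inside \<open>F0inv F y\<close>; the price paid to get there is at most \<open>f x\<close>.

  More precisely, suppose that \<open>F0inv F y\<close> lies at distance greater than \<open>f x\<close> from \<open>x\<close>.
  Descent from \<open>x\<close> stays in the closed ball of radius \<open>f x\<close>, which then misses \<open>F0inv F y\<close>, and
  the whole argument takes place in that ball.  This matters for lower
  semicontinuity: since \<open>delta\<close> is an infimum over \<^emph>\<open>positive\<close> \<open>t\<close> only, it can jump up to
  \<open>\<infinity>\<close> at a point of \<open>F0inv F y\<close>, and closedness of \<open>Finv F y\<close> makes it lower
  semicontinuous only off that set (\<open>delta_lower_semicontinuous\<close>).  Closedness also makes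
  \<open>delta\<close> positive throughout the ball (\<open>delta_eq_0_imp_F0inv\<close>), so that a
  point reached by descent really belongs to \<open>U_set F \<mu> x y\<close> and can be improved, which
  contradicts Ekeland's principle.
\<close>

text \<open>
  Ekeland's principle, with slope one.  A point from which no further descent is possible is found
  as the limit of a greedy sequence in which each step at least halves the distance of \<open>g\<close> to
  its infimum over the points still reachable.  The last hypothesis merges sequential closedness of
  \<open>S\<close> with lower semicontinuity of \<open>g\<close> on \<open>S\<close>: along the sequence the values of \<open>g\<close> converge.
\<close>

lemma ekeland_principle:
  fixes g :: "'a::complete_space \<Rightarrow> real"
  assumes "x \<in> S"
    and nonneg: "\<And>u. u \<in> S \<Longrightarrow> 0 \<le> g u"
    and lsc: "\<And>s u l. \<lbrakk>\<And>n. s n \<in> S; s \<longlonglongrightarrow> u; (\<lambda>n. g (s n)) \<longlonglongrightarrow> l\<rbrakk> \<Longrightarrow> u \<in> S \<and> g u \<le> l"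
  obtains u where "u \<in> S" "g u + dist x u \<le> g x"
    "\<And>v. v \<in> S \<Longrightarrow> g v + dist u v \<le> g u \<Longrightarrow> v = u"
proof -
  define T where "T u = {v \<in> S. g v + dist u v \<le> g u}" for u
  have greedy: "\<exists>v\<in>T u. \<forall>w\<in>T u. 2 * g v \<le> g u + g w" if "u \<in> S" for u
  proof -
    have self: "u \<in> T u" using that by (simp add: T_def)
    have bdd: "bdd_below (g ` T u)" using nonneg by (auto simp: T_def intro!: bdd_belowI2)
    let ?I = "Inf (g ` T u)"
    have low: "?I \<le> g w" if "w \<in> T u" for w
      using bdd that by (intro cInf_lower) auto
    show ?thesis
    proof (cases "?I < g u")
      case True
      then have "?I < (g u + ?I) / 2" by simp
      then obtain v where "v \<in> T u" "g v < (g u + ?I) / 2"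
        using cInf_lessD[of "g ` T u"] self by blast
      then show ?thesis using low by (intro bexI[of _ v]) (auto dest!: low)
    next
      case False
      then show ?thesis using low self by (intro bexI[of _ u]) (auto dest!: low)
    qed
  qed
  then obtain N where N: "\<And>u. u \<in> S \<Longrightarrow> N u \<in> T u"
    "\<And>u w. u \<in> S \<Longrightarrow> w \<in> T u \<Longrightarrow> 2 * g (N u) \<le> g u + g w"
    by metis
  define s where "s n = (N ^^ n) x" for n
  have s0: "s 0 = x" and sSuc: "s (Suc n) = N (s n)" for n by (auto simp: s_def)
  have sS: "s n \<in> S" for n
    by (induction n) (use \<open>x \<in> S\<close> N(1) in \<open>auto simp: s0 sSuc T_def\<close>)
  have reach: "g (s m) + dist (s n) (s m) \<le> g (s n)" if "n \<le> m" for n m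
    using that
  proof (induction m rule: dec_induct)
    case (step m)
    have "g (s (Suc m)) + dist (s m) (s (Suc m)) \<le> g (s m)"
      using N(1)[OF sS] by (simp add: T_def sSuc)
    then show ?case using step.IH dist_triangle[of "s n" "s (Suc m)" "s m"] by linarith
  qed simp
  have dec: "decseq (\<lambda>n. g (s n))"
    unfolding decseq_def
  proof (intro allI impI)
    fix m n :: nat assume "m \<le> n"
    then show "g (s n) \<le> g (s m)" using reach[of m n] zero_le_dist[of "s m" "s n"] by linarith
  qed
  then obtain L where L: "(\<lambda>n. g (s n)) \<longlonglongrightarrow> L" and Lle: "\<And>n. L \<le> g (s n)"
    using decseq_convergent[of "\<lambda>n. g (s n)" 0] nonneg sS by blast
  have "Cauchy s"
  proof (rule metric_CauchyI)
    fix e :: real assume "0 < e"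
    then obtain M where M: "\<And>m n. m \<ge> M \<Longrightarrow> n \<ge> M \<Longrightarrow> dist (g (s m)) (g (s n)) < e"
      using metric_CauchyD[OF LIMSEQ_imp_Cauchy[OF L]] by blast
    have "dist (s m) (s n) < e" if "m \<ge> M" "n \<ge> M" for m n
    proof (cases "m \<le> n")
      case True
      then show ?thesis using reach[OF True] M[OF that] by (auto simp: dist_real_def)
    next
      case False
      then show ?thesis using reach[of n m] M[OF that] by (auto simp: dist_real_def dist_commute)
    qed
    then show "\<exists>M. \<forall>m\<ge>M. \<forall>n\<ge>M. dist (s m) (s n) < e" by blast
  qed
  then obtain u where u: "s \<longlonglongrightarrow> u"
    using Cauchy_convergent_iff convergent_def by blast
  have uS: "u \<in> S" and guL: "g u \<le> L" using lsc[OF sS u L] by auto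
  have u_reach: "g u + dist (s n) u \<le> g (s n)" for n
  proof -
    have "(\<lambda>m. g (s m) + dist (s n) (s m)) \<longlonglongrightarrow> L + dist (s n) u"
      by (intro tendsto_intros L u)
    then have "L + dist (s n) u \<le> g (s n)"
      by (rule LIMSEQ_le_const2) (use reach in blast)
    then show ?thesis using guL by simp
  qed
  have "v = u" if "v \<in> S" and v: "g v + dist u v \<le> g u" for v
  proof -
    have "2 * g (s (Suc n)) \<le> g (s n) + g v" for n
    proof -
      have "v \<in> T (s n)"
        using that u_reach[of n] dist_triangle[of "s n" v u] by (simp add: T_def)
      then show ?thesis using N(2)[OF sS] by (simp add: sSuc)
    qed
    moreover have "(\<lambda>n. 2 * g (s (Suc n))) \<longlonglongrightarrow> 2 * L"
      by (intro tendsto_intros LIMSEQ_Suc[OF L])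
    moreover have "(\<lambda>n. g (s n) + g v) \<longlonglongrightarrow> L + g v"
      by (intro tendsto_intros L)
    ultimately have "2 * L \<le> L + g v"
      using LIMSEQ_le by blast
    then have "dist u v \<le> 0" using v guL by linarith
    then show ?thesis by simp
  qed
  then show ?thesis using that uS u_reach[of 0] by (simp add: s0)
qed

lemma closed_Finv:
  fixes F :: "'a::metric_space \<times> real \<Rightarrow> 'b set"
  assumes "inverse_closed_valued_on F V" "y \<in> V"
  shows "closed (Finv F y)"
proof -
  have "closed (UNIV \<times> {0::real..} :: ('a \<times> real) set)" by (intro closed_Times) auto
  then show ?thesis
    using assms closedin_closed_trans by (auto simp: inverse_closed_valued_on_def)
qed

lemma delta_lessE:
  assumes "delta y F u < c"
  obtains t where "0 < t" "y \<in> F (u, t)" "ennreal t < c"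
  using assms by (auto simp: delta_def Inf_less_iff)

lemma delta_le: "0 < t \<Longrightarrow> y \<in> F (u, t) \<Longrightarrow> delta y F u \<le> ennreal t"
  by (auto simp: delta_def intro!: Inf_lower)

lemma delta_eq_0_imp_F0inv:
  fixes F :: "'a::metric_space \<times> real \<Rightarrow> 'b set"
  assumes "closed (Finv F y)" "delta y F u = 0"
  shows "u \<in> F0inv F y"
proof -
  have "closed (Pair u -` Finv F y)"
    by (intro closed_vimage assms(1) continuous_intros)
  moreover have "0 \<in> closure (Pair u -` Finv F y)"
    unfolding closure_approachable
  proof (intro allI impI)
    fix e :: real assume "0 < e"
    then obtain t where "0 < t" "y \<in> F (u, t)" "ennreal t < ennreal e"
      using assms(2) delta_lessE[of y F u "ennreal e"] by auto
    then show "\<exists>t\<in>Pair u -` Finv F y. dist t 0 < e"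
      by (intro bexI[of _ t]) (auto simp: Finv_def ennreal_less_iff)
  qed
  ultimately show ?thesis by (simp add: Finv_def F0inv_def)
qed

text \<open>
  For real \<open>c\<close> the points \<open>u\<close> with \<open>y \<in> F (u, t)\<close> for some \<open>t \<in> [0, c]\<close> form a closed set, because
  projecting along the compact interval preserves closedness.  Off \<open>F0inv F y\<close> these sets are, up
  to the boundary value \<open>c\<close>, the sublevel sets of \<open>delta\<close>.
\<close>

lemma delta_lower_semicontinuous:
  fixes F :: "'a::metric_space \<times> real \<Rightarrow> 'b set"
  assumes cl: "closed (Finv F y)" and v: "v \<notin> F0inv F y"
    and s: "s \<longlonglongrightarrow> v" and d: "(\<lambda>n. delta y F (s n)) \<longlonglongrightarrow> d"
  shows "delta y F v \<le> d"
proof (rule dense_ge)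
  fix e assume "d < e"
  then obtain b where b: "d < b" "b < e" using dense by blast
  then have "b \<noteq> top" using top.extremum_strict by blast
  then obtain c where c: "0 \<le> c" "d < ennreal c" "ennreal c < e"
    using b by (cases b) auto
  define A where "A = {u. \<exists>t\<in>{0..c}. (u, t) \<in> Finv F y}"
  have "closed A"
  proof -
    have "closed_map (prod_topology euclidean (top_of_set {0..c})) euclidean (fst :: 'a \<times> real \<Rightarrow> 'a)"
      by (intro closed_map_fst) (simp add: compact_space_subtopology)
    moreover have "closedin (prod_topology euclidean (top_of_set {0..c})) (Finv F y \<inter> UNIV \<times> {0..c})"
      using cl by (auto simp: prod_topology_subtopology closedin_closed)
    ultimately have "closed (fst ` (Finv F y \<inter> UNIV \<times> {0..c}))"
      by (auto simp: closed_map_def)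
    also have "fst ` (Finv F y \<inter> UNIV \<times> {0..c}) = A"
      by (force simp: A_def)
    finally show ?thesis .
  qed
  moreover have "eventually (\<lambda>n. s n \<in> A) sequentially"
    using order_tendstoD(2)[OF d c(2)]
  proof eventually_elim
    case (elim n)
    then show ?case
      by (rule delta_lessE) (use c(1) in \<open>auto simp: A_def Finv_def ennreal_less_iff intro!: less_imp_le\<close>)
  qed
  ultimately have "v \<in> A"
    by (rule Lim_in_closed_set) (use s in auto)
  then obtain t where t: "0 \<le> t" "t \<le> c" "y \<in> F (v, t)"
    unfolding A_def Finv_def by auto
  have "t \<noteq> 0" using t(3) v unfolding F0inv_def by blast
  then have "delta y F v \<le> ennreal t" using t by (intro delta_le) simp_all
  also have "\<dots> \<le> ennreal c" using t(2) by (rule ennreal_leI)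
  finally show "delta y F v \<le> e" using c(3) by (rule order_trans[OF _ less_imp_le])
qed

text \<open>
  Composition with \<open>\<mu>\<close> preserves this.  The values of \<open>delta\<close> need not converge
  together with those of \<open>\<mu> \<circ> delta\<close>, since \<open>\<mu>\<close> may be constant on intervals; compactness of
  \<open>[0,\<infinity>]\<close> supplies a subsequence along which they do.
\<close>

lemma modulus_delta_lower_semicontinuous:
  fixes F :: "'a::metric_space \<times> real \<Rightarrow> 'b set"
  assumes "closed (Finv F y)" "v \<notin> F0inv F y" "continuous_on UNIV \<mu>" "mono \<mu>"
    and "s \<longlonglongrightarrow> v" "(\<lambda>n. \<mu> (delta y F (s n))) \<longlonglongrightarrow> l"
  shows "\<mu> (delta y F v) \<le> (l :: ennreal)"
proof -
  obtain d r where r: "strict_mono (r :: nat \<Rightarrow> nat)" "((\<lambda>n. delta y F (s n)) \<circ> r) \<longlonglongrightarrow> d"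
    using compact_complete_linorder by blast
  have "(\<lambda>n. \<mu> (delta y F (s (r n)))) \<longlonglongrightarrow> \<mu> d"
    using continuous_on_tendsto_compose[OF assms(3) r(2)] by (simp add: o_def)
  moreover have "(\<lambda>n. \<mu> (delta y F (s (r n)))) \<longlonglongrightarrow> l"
    using LIMSEQ_subseq_LIMSEQ[OF assms(6) r(1)] by (simp add: o_def)
  ultimately have "\<mu> d = l" by (rule LIMSEQ_unique)
  moreover have "delta y F v \<le> d"
    using delta_lower_semicontinuous[OF assms(1,2) LIMSEQ_subseq_LIMSEQ[OF assms(5) r(1)]] r(2)
    by (simp add: o_def)
  ultimately show ?thesis using monoD[OF assms(4)] by blast
qed

theorem theorem3p5:
  fixes F :: "'a::complete_space \<times> real \<Rightarrow> 'b::metric_space set"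
    and W :: "('a \<times> 'b) set"
    and \<mu> :: "ennreal \<Rightarrow> ennreal"
  assumes "continuous_on UNIV \<mu>"
    and "mono \<mu>"
    and "\<And>\<tau>. \<mu> \<tau> = 0 \<longleftrightarrow> \<tau> = 0"
    and "inverse_closed_valued_on F (snd ` W)"
    and "\<And>x y u. (x, y) \<in> W \<Longrightarrow> u \<in> U_set F \<mu> x y \<Longrightarrow>
           \<exists>u'. u' \<noteq> u \<and>
             enn2ereal (\<mu> (delta y F u')) \<le> enn2ereal (\<mu> (delta y F u)) - ereal (dist u u')"
  shows "regular_on F W \<mu>"
  unfolding regular_on_def
proof clarify
  fix x y assume W: "(x, y) \<in> W"
  then have cl: "closed (Finv F y)" using closed_Finv[OF assms(4)] by force
  define f where "f u = \<mu> (delta y F u)" for u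
  show "edist_set x (F0inv F y) \<le> \<mu> (delta y F x)"
  proof (rule ccontr)
    assume "\<not> ?thesis"
    then have far: "f x < edist_set x (F0inv F y)" by (simp add: f_def)
    then have "f x < top" using less_top top.not_eq_extremum by fastforce
    then obtain m where m: "0 \<le> m" "f x = ennreal m" by (cases "f x") auto
    have off: "u \<notin> F0inv F y" if "dist x u \<le> m" for u
    proof
      assume "u \<in> F0inv F y"
      then have "edist_set x (F0inv F y) \<le> ennreal (dist x u)"
        unfolding edist_set_def by (rule INF_lower)
      also have "\<dots> \<le> f x" using that m by (simp add: ennreal_leI)
      finally show False using far by simp
    qed
    \<comment> \<open>Only points with \<open>f u \<le> f x\<close> occur, so that \<open>f\<close> may be treated as real-valued.\<close>
    define S where "S = {u. dist x u \<le> m \<and> f u \<le> ennreal m}"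
    define g where "g u = enn2real (f u)" for u
    have g0: "0 \<le> g u" for u by (simp add: g_def)
    have fg: "f u = ennreal (g u)" if "u \<in> S" for u
    proof -
      have "f u < top" using that le_less_trans[OF _ ennreal_less_top] by (auto simp: S_def)
      then show ?thesis by (simp add: g_def)
    qed
    have "x \<in> S" using m by (simp add: S_def)
    obtain u where u: "u \<in> S" "g u + dist x u \<le> g x"
      and stuck: "\<And>v. v \<in> S \<Longrightarrow> g v + dist u v \<le> g u \<Longrightarrow> v = u"
    proof (rule ekeland_principle[of x S g])
      show "x \<in> S" by fact
      show "0 \<le> g u" for u by (rule g0)
      fix s u l
      assume s: "\<And>n. s n \<in> S" "s \<longlonglongrightarrow> u" and l: "(\<lambda>n. g (s n)) \<longlonglongrightarrow> l"
      have "(\<lambda>n. dist x (s n)) \<longlonglongrightarrow> dist x u" by (intro tendsto_intros s)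
      then have du: "dist x u \<le> m"
        by (rule LIMSEQ_le_const2) (use s(1) in \<open>auto simp: S_def\<close>)
      have "0 \<le> l" by (rule LIMSEQ_le_const[OF l]) (simp add: g0)
      have lim: "(\<lambda>n. f (s n)) \<longlonglongrightarrow> ennreal l"
        using tendsto_ennrealI[OF l] fg[OF s(1)] by simp
      then have "f u \<le> ennreal l"
        using modulus_delta_lower_semicontinuous[OF cl off[OF du] assms(1,2) s(2)]
        by (simp add: f_def)
      moreover have "ennreal l \<le> ennreal m"
        by (rule LIMSEQ_le_const2[OF lim]) (use s(1) in \<open>auto simp: S_def\<close>)
      ultimately have "u \<in> S" using du by (simp add: S_def)
      moreover have "g u \<le> l"
        using \<open>f u \<le> ennreal l\<close> \<open>0 \<le> l\<close> fg[OF \<open>u \<in> S\<close>] by simp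
      ultimately show "u \<in> S \<and> g u \<le> l" by simp
    qed blast
    have gx: "g x = m" using m by (simp add: g_def)
    have du: "dist x u \<le> m" using u(1) by (simp add: S_def)
    have "delta y F u \<noteq> 0" using delta_eq_0_imp_F0inv[OF cl] off[OF du] by blast
    moreover have "f u + ennreal (dist u x) \<le> f x"
    proof -
      have "f u + ennreal (dist u x) = ennreal (g u + dist x u)"
        using ennreal_plus[of "g u" "dist x u"] fg[OF u(1)] g0 by (simp add: dist_commute)
      also have "\<dots> \<le> f x" using ennreal_leI[OF u(2)] fg[OF \<open>x \<in> S\<close>] by simp
      finally show ?thesis .
    qed
    ultimately have "u \<in> U_set F \<mu> x y"
      by (simp add: U_set_def f_def zero_less_iff_neq_zero)
    then obtain v where v: "v \<noteq> u" "enn2ereal (f v) \<le> enn2ereal (f u) - ereal (dist u v)"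
      using assms(5)[OF W] by (auto simp: f_def)
    then have le: "enn2ereal (f v) \<le> ereal (g u - dist u v)"
      using fg[OF u(1)] g0[of u] by (simp add: enn2ereal_ennreal)
    then have "f v \<noteq> top" by auto
    then have fv: "f v = ennreal (g v)" by (simp add: g_def less_top)
    have desc: "g v + dist u v \<le> g u" using le fv g0[of v] by (simp add: enn2ereal_ennreal)
    have "dist x v \<le> m" "g v \<le> m"
      using desc u(2) gx dist_triangle[of x v u] g0[of v] g0[of u]
        zero_le_dist[of u v] zero_le_dist[of x u] by linarith+
    then have "v \<in> S" using fv by (simp add: S_def ennreal_leI)
    then show False using stuck desc v(1) by blast
  qed
qed

end
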